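(* Let $n$ be a positive integer, let $X_1, X_2, \dots, X_n$ be independent and identically distributed Gaussian random variables with mean zero and variance one, and let $\sigma_1, \sigma_2, \dots, \sigma_n$ be positive real numbers. Define the random variable \[ X = \sum_{k=1}^n |\sigma_k X_k|^2 . \] Then the cumulative distribution function $P(x) = \Pr(X \le x)$ of $X$ satisfies $P(x) = 0$ for every real $x \le 0$, and for every real $x > 0$, \[ P(x) = \int_0^\infty \operatorname{Im}\left( \frac{e^{1-t}\, e^{i t \sqrt{n}}}{\pi \left( t - \frac{1}{1 - i\sqrt{n}} \right) \prod_{k=1}^n \sqrt{1 - 2(t-1)\sigma_k^2/x + 2 i t \sigma_k^2 \sqrt{n}/x}} \right) dt , \] where each square root denotes the principal branch and $\operatorname{Im}$ denotes the imaginary part.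
   Context: $i$ denotes the imaginary unit. The principal branch of the square root of a nonzero complex number $z$ is the value with nonnegative real part (branch cut along the negative real axis). *)

theory Defs
  imports "HOL-Probability.Probability"
begin

end

theory Submission
  imports Defs "HOL-Complex_Analysis.Conformal_Mappings"
begin

text \<open>
  After division by x one has to find the probability that Y = sum_k a_k X_k^2 is at most 1. The
  Laplace transform phi of Y is a product of factors (1 + 2 a_k z)^(-1/2), holomorphic off a
  half-line of the negative real axis. Levy's inversion formula for the interval (0, 1] is the
  integral of (e^z - 1) phi(z) / z over the imaginary axis; by symmetry its upper half suffices.
  There the contour is moved to the ray z = 1 - t + i t r, on which e^z decays exponentially.
  As |phi(z)| = O(|z|^(-1/2)), the connecting segments contribute nothing in the limit, and the
  term phi(z) / z alone disappears by moving its contour to the far right instead. With r = sqrt n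
  and z = -(1 - i r) (t - 1 / (1 - i r)) this is the stated integral.
\<close>

section \<open>The Laplace transform of the square of a Gaussian\<close>

text \<open>On the imaginary axis \<open>exp z - 1\<close> must stay whole:
  \<open>exp z * phi z / z\<close> and \<open>phi z / z\<close> each have a pole at 0, on that very
  contour, and only their difference extends continuously. They can be separated only away from 0,
  which is why the ray starts at a positive real point. Hence there are two primitives on two cut
  planes: \<open>K\<close> of \<open>kern\<close>, on a domain containing 0, and \<open>L\<close> of
  \<open>phi z / z\<close>, on one that omits 0. With them every contour integral is a difference of
  end values, and Cauchy's theorem enters only as the existence of primitives on starlike domains.
  Only imaginary parts are compared, and all integrands are real on the positive axis, so moving
  along that axis costs nothing. Levy's formula also asks that the end points of the interval carry
  no mass. This is obtained from independence, without a density of Y. The argument works for every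
  slope r > 0; sqrt n is inserted only at the end.\<close>

lemma integrable_gaussian_exp_square:
  assumes "Re s \<ge> - (1/4)"
  shows "integrable lborel (\<lambda>x. std_normal_density x *\<^sub>R exp (- s * complex_of_real (x\<^sup>2)))"
    and "norm (std_normal_density x *\<^sub>R exp (- s * complex_of_real (x\<^sup>2)))
           \<le> sqrt 2 * normal_density 0 (sqrt 2) x"
proof -
  show le: "norm (std_normal_density x *\<^sub>R exp (- s * complex_of_real (x\<^sup>2)))
           \<le> sqrt 2 * normal_density 0 (sqrt 2) x" for x
  proof -
    have "norm (std_normal_density x *\<^sub>R exp (- s * complex_of_real (x\<^sup>2)))
        = std_normal_density x * exp (- Re s * x\<^sup>2)"
      by simp
    \<comment> \<open>For \<open>Re s\<close> at least -1/4 half of the Gaussian exponent survives.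
      What remains, \<open>exp (- x^2 / 4)\<close> up to a constant, is the Gaussian of variance 2,
      hence the majorant.\<close>
    also have "\<dots> \<le> std_normal_density x * exp (x\<^sup>2 / 4)"
      using mult_right_mono[of "- Re s" "1/4" "x\<^sup>2"] assms by (intro mult_left_mono) auto
    also have "\<dots> = sqrt 2 * normal_density 0 (sqrt 2) x"
      by (simp add: normal_density_def real_sqrt_mult field_simps flip: exp_add)
    finally show ?thesis .
  qed
  show "integrable lborel (\<lambda>x. std_normal_density x *\<^sub>R exp (- s * complex_of_real (x\<^sup>2)))"
    by (rule Bochner_Integration.integrable_bound
          [of _ "\<lambda>x. sqrt 2 * normal_density 0 (sqrt 2) x"])
       (use le in \<open>auto simp del: norm_scaleR\<close>)
qed

lemma norm_indicator_scaleR_le: "0 \<le> c \<Longrightarrow> norm (indicator A x *\<^sub>R c) \<le> (c::real)"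
  by (cases "x \<in> A") auto

text \<open>Weierstrass' theorem: the integrals over \<open>[-N, N]\<close> are holomorphic by the
  Leibniz rule, and the missing tails are bounded by those of one majorant \<open>?w\<close>
  independent of s, so the convergence is uniform.\<close>

lemma holomorphic_gaussian_exp_square:
  "(\<lambda>s. LINT x|lborel. std_normal_density x *\<^sub>R exp (- s * complex_of_real (x\<^sup>2)))
     holomorphic_on {s. Re s > - (1/4)}"
proof (rule holomorphic_uniform_sequence)
  let ?g = "\<lambda>s x. std_normal_density x *\<^sub>R exp (- s * complex_of_real (x\<^sup>2))"
  let ?U = "{s. Re s > - (1/4)}"
  let ?w = "\<lambda>x. sqrt 2 * normal_density 0 (sqrt 2) x"
  show op: "open ?U" by (rule open_halfspace_Re_gt)
  show "(\<lambda>s. integral (cbox (- real N) (real N)) (?g s)) holomorphic_on ?U" for N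
  proof (rule leibniz_rule_holomorphic)
    show "((\<lambda>s. ?g s x) has_field_derivative
        std_normal_density x *\<^sub>R (- complex_of_real (x\<^sup>2) * exp (- s * complex_of_real (x\<^sup>2))))
        (at s within ?U)" for s x
      by (auto intro!: derivative_eq_intros simp: scaleR_conv_of_real)
    show "?g s integrable_on cbox (- real N) (real N)" for s
      unfolding std_normal_density_def by (intro integrable_continuous continuous_intros) auto
    show "continuous_on (?U \<times> cbox (- real N) (real N)) (\<lambda>(s, x).
        std_normal_density x *\<^sub>R (- complex_of_real (x\<^sup>2) * exp (- s * complex_of_real (x\<^sup>2))))"
      unfolding split_beta std_normal_density_def by (intro continuous_intros) auto
    show "convex ?U" by (rule convex_halfspace_Re_gt)
  qed
  fix s assume "s \<in> ?U"
  then obtain d where d: "0 < d" "cball s d \<subseteq> ?U"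
    using op open_contains_cball by blast
  have intw: "integrable lborel ?w" by simp
  have tail: "(\<lambda>N. LINT x|lborel. indicator (- {- real N..real N}) x *\<^sub>R ?w x) \<longlonglongrightarrow> (LINT x|(lborel :: real measure). 0)"
  proof (rule integral_dominated_convergence[where w = ?w and f = "\<lambda>_. 0"
        and s = "\<lambda>N x. indicator (- {- real N..real N}) x *\<^sub>R ?w x"])
    show "AE x in lborel. (\<lambda>N. indicator (- {- real N..real N}) x *\<^sub>R ?w x) \<longlonglongrightarrow> 0"
    proof (rule AE_I2)
      fix x :: real
      obtain N0 :: nat where N0: "\<bar>x\<bar> \<le> N0" using real_arch_simple by blast
      have "indicator (- {- real N..real N}) x *\<^sub>R ?w x = 0" if "N \<ge> N0" for N
      proof -
        have "x \<in> {- real N..real N}" using N0 that by auto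
        then have "indicator (- {- real N..real N}) x = (0::real)" by simp
        then show ?thesis by simp
      qed
      then have "eventually (\<lambda>N. indicator (- {- real N..real N}) x *\<^sub>R ?w x = 0) sequentially"
        unfolding eventually_sequentially by blast
      then show "(\<lambda>N. indicator (- {- real N..real N}) x *\<^sub>R ?w x) \<longlonglongrightarrow> 0"
        by (rule tendsto_eventually)
    qed
    show "AE x in lborel. norm (indicator (- {- real N..real N}) x *\<^sub>R ?w x) \<le> ?w x" for N
      by (intro AE_I2 norm_indicator_scaleR_le) simp
    show "(\<lambda>x. indicator (- {- real N..real N}) x *\<^sub>R ?w x) \<in> borel_measurable lborel" for N
      by measurable
  qed (rule borel_measurable_const intw)+
  have bnd: "norm (integral (cbox (- real N) (real N)) (?g z) - (LINT x|lborel. ?g z x))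
      \<le> (LINT x|lborel. indicator (- {- real N..real N}) x *\<^sub>R ?w x)" if z: "z \<in> ?U" for z N
  proof -
    define h where "h = ?g z"
    have int: "integrable lborel h"
      unfolding h_def using integrable_gaussian_exp_square(1)[of z] z by auto
    have h_le: "norm (h x) \<le> ?w x" for x
      unfolding h_def by (rule integrable_gaussian_exp_square(2)) (use z in auto)
    have si: "integrable lborel (\<lambda>x. indicator A x *\<^sub>R h x)" if "A \<in> sets borel" for A
      by (rule integrable_mult_indicator) (use int that in auto)
    have siN: "integrable lborel (\<lambda>x. indicator {- real N..real N} x *\<^sub>R h x)"
      by (rule si) simp
    have "integral (cbox (- real N) (real N)) h = (LINT x|lborel. indicator {- real N..real N} x *\<^sub>R h x)"
      using set_borel_integral_eq_integral(2)[of "{- real N..real N}" h] siN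
      by (simp add: set_integrable_def set_lebesgue_integral_def)
    also have "\<dots> - (LINT x|lborel. h x)
        = (LINT x|lborel. indicator {- real N..real N} x *\<^sub>R h x - h x)"
      by (rule Bochner_Integration.integral_diff[OF siN int, symmetric])
    also have "\<dots> = (LINT x|lborel. - (indicator (- {- real N..real N}) x *\<^sub>R h x))"
      by (rule Bochner_Integration.integral_cong) (simp_all split: split_indicator)
    also have "\<dots> = - (LINT x|lborel. indicator (- {- real N..real N}) x *\<^sub>R h x)"
      by (rule Bochner_Integration.integral_minus)
    also have "norm \<dots> \<le> (LINT x|lborel. indicator (- {- real N..real N}) x *\<^sub>R ?w x)"
      unfolding norm_minus_cancel
    proof (rule Bochner_Integration.integral_norm_bound_integral)
      show "integrable lborel (\<lambda>x. indicator (- {- real N..real N}) x *\<^sub>R h x)"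
        by (rule si) simp
      show "integrable lborel (\<lambda>x. indicator (- {- real N..real N}) x *\<^sub>R ?w x)"
        by (rule integrable_mult_indicator[OF _ intw]) simp
      show "norm (indicator (- {- real N..real N}) x *\<^sub>R h x)
          \<le> indicator (- {- real N..real N}) x *\<^sub>R ?w x" for x
        using h_le[of x] by (cases "x \<in> {- real N..real N}") auto
    qed
    finally show ?thesis by (simp only: h_def)
  qed
  have "uniform_limit (cball s d) (\<lambda>N s. integral (cbox (- real N) (real N)) (?g s))
       (\<lambda>s. LINT x|lborel. ?g s x) sequentially"
  proof (rule uniform_limitI)
    fix e :: real assume "e > 0"
    then have "eventually (\<lambda>N. (LINT x|lborel. indicator (- {- real N..real N}) x *\<^sub>R ?w x) < e) sequentially"
      using tail by (auto intro: order_tendstoD)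
    then show "\<forall>\<^sub>F N in sequentially. \<forall>z\<in>cball s d.
        dist (integral (cbox (- real N) (real N)) (?g z)) (LINT x|lborel. ?g z x) < e"
    proof eventually_elim
      case (elim N)
      show ?case
      proof
        fix z assume "z \<in> cball s d"
        then have "z \<in> ?U" using d by auto
        from bnd[OF this, of N] elim
        show "dist (integral (cbox (- real N) (real N)) (?g z)) (LINT x|lborel. ?g z x) < e"
          by (simp add: dist_norm)
      qed
    qed
  qed
  then show "\<exists>d>0. cball s d \<subseteq> ?U \<and>
     uniform_limit (cball s d) (\<lambda>N s. integral (cbox (- real N) (real N)) (?g s))
       (\<lambda>s. LINT x|lborel. ?g s x) sequentially"
    using d by blast
qed

lemma gaussian_exp_square_real:
  assumes "s > - (1/2)"
  shows "(LINT x|lborel. std_normal_density x * exp (- s * x\<^sup>2)) = 1 / sqrt (1 + 2 * s)"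
proof -
  let ?q = "sqrt (1 + 2 * s)"
  have pos: "1 + 2 * s > 0" using assms by simp
  have "std_normal_density x * exp (- s * x\<^sup>2) = (1 / ?q) * normal_density 0 (1 / ?q) x" for x
  proof -
    have "- (x\<^sup>2) / 2 + - s * x\<^sup>2 = - (x\<^sup>2 * (1 + 2 * s) / 2)" by (simp add: field_simps)
    then show ?thesis using pos
      by (simp add: normal_density_def power_divide real_sqrt_divide flip: exp_add)
  qed
  then show ?thesis using pos by simp
qed

text \<open>Identity theorem: both sides are holomorphic on the half-plane and agree on the positive
  reals, which accumulate at 0. The half-plane reaches to the left of the imaginary axis so that
  purely imaginary s, the case of characteristic functions, are interior points.\<close>

lemma gaussian_exp_square:
  assumes "Re s > - (1/4)"
  shows "(LINT x|lborel. std_normal_density x *\<^sub>R exp (- s * complex_of_real (x\<^sup>2)))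
           = 1 / csqrt (1 + 2 * s)"
proof -
  let ?U = "{s. Re s > - (1/4)}"
  let ?f = "\<lambda>s. (LINT x|lborel. std_normal_density x *\<^sub>R exp (- s * complex_of_real (x\<^sup>2)))
               - 1 / csqrt (1 + 2 * s)"
  have slit: "1 + 2 * s \<notin> \<real>\<^sub>\<le>\<^sub>0" if "s \<in> ?U" for s
    using that by (auto simp: complex_nonpos_Reals_iff)
  have nz: "csqrt (1 + 2 * s) \<noteq> 0" if "s \<in> ?U" for s
    using slit[OF that] by auto
  have "?f s = 0"
  proof (rule analytic_continuation[of ?f ?U "complex_of_real ` {0<..}" 0])
    show "?f holomorphic_on ?U"
      using slit nz
      by (intro holomorphic_intros holomorphic_gaussian_exp_square) 
         (auto intro!: holomorphic_intros)
    show "(0::complex) islimpt complex_of_real ` {0<..}"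
      unfolding islimpt_approachable
    proof (intro allI impI)
      fix e :: real assume "e > 0"
      then show "\<exists>x'\<in>complex_of_real ` {0<..}. x' \<noteq> 0 \<and> dist x' 0 < e"
        by (intro bexI[of _ "complex_of_real (e/2)"] imageI) auto
    qed
    show "?f z = 0" if "z \<in> complex_of_real ` {0<..}" for z
    proof -
      from that obtain r where r: "r > 0" "z = of_real r" by auto
      have "std_normal_density x *\<^sub>R exp (- z * complex_of_real (x\<^sup>2))
          = complex_of_real (std_normal_density x * exp (- r * x\<^sup>2))" for x
        by (simp add: r(2) scaleR_conv_of_real exp_of_real[symmetric])
      then have "(LINT x|lborel. std_normal_density x *\<^sub>R exp (- z * complex_of_real (x\<^sup>2)))
          = complex_of_real (1 / sqrt (1 + 2 * r))"
        using gaussian_exp_square_real[of r] r(1) by (simp del: of_real_mult)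
      moreover have "csqrt (1 + 2 * z) = complex_of_real (sqrt (1 + 2 * r))"
        using r csqrt_of_real_nonneg[of "complex_of_real (1 + 2 * r)"] by simp
      ultimately show ?thesis by simp
    qed
    show "connected ?U" by (rule convex_connected[OF convex_halfspace_Re_gt])
  qed (use assms in \<open>auto intro: open_halfspace_Re_gt\<close>)
  then show ?thesis by simp
qed

section \<open>Quadratic forms in independent Gaussians\<close>

context prob_space
begin

lemma char_scaled_square_std_normal:
  assumes X: "distributed M lborel X std_normal_density"
  shows "char (distr M borel (\<lambda>\<omega>. a * (X \<omega>)\<^sup>2)) t = 1 / csqrt (1 - 2 * \<i> * complex_of_real (a * t))"
proof -
  have meas: "X \<in> borel_measurable M"
    using distributed_measurable[OF X] by simp
  have "char (distr M borel (\<lambda>\<omega>. a * (X \<omega>)\<^sup>2)) t = (CLINT \<omega>|M. iexp (t * (a * (X \<omega>)\<^sup>2)))"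
    unfolding char_def by (rule integral_distr) (use meas in measurable)
  also have "\<dots> = (CLINT x|distr M lborel X. iexp (t * (a * x\<^sup>2)))"
    by (rule integral_distr[symmetric]) (use distributed_measurable[OF X] in measurable)
  also have "\<dots> = (CLINT x|density lborel std_normal_density. iexp (t * (a * x\<^sup>2)))"
    using distributed_distr_eq_density[OF X] by simp
  also have "\<dots> = (CLINT x|lborel. std_normal_density x *\<^sub>R iexp (t * (a * x\<^sup>2)))"
    by (rule integral_density) auto
  also have "\<dots> = (CLINT x|lborel. std_normal_density x *\<^sub>R
      exp (- (- \<i> * complex_of_real (a * t)) * complex_of_real (x\<^sup>2)))"
    by (simp add: mult_ac)
  also have "\<dots> = 1 / csqrt (1 - 2 * \<i> * complex_of_real (a * t))"
    by (subst gaussian_exp_square) (simp_all add: mult.assoc)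
  finally show ?thesis .
qed

text \<open>A level set of \<open>a * x^2\<close> has at most two points, so it is a null set for
  any density.\<close>

lemma emeasure_scaled_square_std_normal_singleton:
  assumes X: "distributed M lborel X std_normal_density" and a: "a \<noteq> 0"
  shows "emeasure (distr M borel (\<lambda>\<omega>. a * (X \<omega>)\<^sup>2)) {y} = 0"
proof -
  let ?A = "{x::real. a * x\<^sup>2 = y}"
  have meas [measurable]: "X \<in> borel_measurable M"
    using distributed_measurable[OF X] by simp
  have "?A \<subseteq> {sqrt (y / a), - sqrt (y / a)}"
    using a by (auto simp: real_sqrt_abs)
  then have "finite ?A" by (rule finite_subset) simp
  then have null: "?A \<in> null_sets lborel" by (rule finite_imp_null_set_lborel)
  then have A: "?A \<in> sets lborel" by auto
  have "emeasure (distr M borel (\<lambda>\<omega>. a * (X \<omega>)\<^sup>2)) {y} = emeasure (distr M lborel X) ?A"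
    by (subst (1 2) emeasure_distr) (use A in \<open>auto intro!: arg_cong[where f = "emeasure M"]\<close>)
  also have "\<dots> = emeasure (density lborel std_normal_density) ?A"
    using distributed_distr_eq_density[OF X] by simp
  also have "\<dots> = 0"
  proof -
    have "?A \<in> null_sets (density lborel (\<lambda>x. ennreal (std_normal_density x)))"
      using absolutely_continuousI_density[of "\<lambda>x. ennreal (std_normal_density x)" lborel] null
      unfolding absolutely_continuous_def by auto
    then show ?thesis by (rule null_setsD1)
  qed
  finally show ?thesis .
qed

text \<open>One atomless summand suffices: given the other summands, the sum equals y only if
  \<open>Z j\<close> hits one prescribed point.\<close>

lemma emeasure_indep_sum_singleton:
  fixes Z :: "'i \<Rightarrow> 'a \<Rightarrow> real"
  assumes ind: "indep_vars (\<lambda>_. borel) Z I" and I: "finite I" "j \<in> I"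
    and Zj: "\<And>y. emeasure (distr M borel (Z j)) {y} = 0"
  shows "emeasure (distr M borel (\<lambda>\<omega>. \<Sum>i\<in>I. Z i \<omega>)) {y} = 0"
proof -
  let ?W = "\<lambda>\<omega>. \<Sum>i\<in>I - {j}. Z i \<omega>"
  have iv: "indep_var borel (Z j) borel ?W"
    using I ind by (intro indep_vars_sum) (auto simp: insert_absorb)
  have [measurable]: "random_variable borel (Z j)" "random_variable borel ?W"
    using indep_var_rv1[OF iv] indep_var_rv2[OF iv] by auto
  have fin: "finite_measure (distr M borel f)" if "random_variable borel f" for f :: "'a \<Rightarrow> real"
    using prob_space_distr[OF that] by (simp add: prob_space.finite_measure)
  have "distr M borel (\<lambda>\<omega>. \<Sum>i\<in>I. Z i \<omega>) = distr M borel (\<lambda>\<omega>. Z j \<omega> + ?W \<omega>)"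
    using I by (simp add: sum.remove)
  also have "\<dots> = convolution (distr M borel (Z j)) (distr M borel ?W)"
    by (rule sum_indep_random_variable[OF iv]) measurable
  \<comment> \<open>The factors are swapped so that \<open>convolution_emeasure\<close> puts the law
    of \<open>Z j\<close> inside the integral, where its singletons vanish.\<close>
  also have "\<dots> = convolution (distr M borel ?W) (distr M borel (Z j))"
    by (rule convolution_commutative) (auto intro!: fin)
  also have "emeasure \<dots> {y} = (\<integral>\<^sup>+x. emeasure (distr M borel (Z j)) {a. a + x \<in> {y}} \<partial>distr M borel ?W)"
    by (rule convolution_emeasure) (auto intro!: fin)
  also have "\<dots> = (\<integral>\<^sup>+x. 0 \<partial>distr M borel ?W)"
  proof (rule nn_integral_cong)
    fix x
    have "{a. a + x \<in> {y}} = {y - x}" by auto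
    then show "emeasure (distr M borel (Z j)) {a. a + x \<in> {y}} = 0" using Zj by simp
  qed
  finally show ?thesis by simp
qed

end

section \<open>Deforming the inversion contour\<close>

lemma open_slit: "open {z. Im z \<noteq> 0 \<or> Re z > d}"
proof -
  have "{z. Im z \<noteq> 0 \<or> Re z > d} = ({z. Im z < 0} \<union> {z. Im z > 0}) \<union> {z. Re z > d}" by auto
  then show ?thesis
    by (simp add: open_Un open_halfspace_Im_lt open_halfspace_Im_gt open_halfspace_Re_gt)
qed

text \<open>The segment from the centre 1 to a non-real point is non-real except at 1, and the
  segment to a real point stays on the uncut half-line.\<close>

lemma starlike_slit:
  assumes "d < 1"
  shows "starlike {z. Im z \<noteq> 0 \<or> Re z > d}"
  unfolding starlike_def
proof (intro bexI ballI subsetI)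
  show "(1::complex) \<in> {z. Im z \<noteq> 0 \<or> Re z > d}" using assms by simp
next
  fix x y :: complex
  assume x: "x \<in> {z. Im z \<noteq> 0 \<or> Re z > d}" and "y \<in> closed_segment 1 x"
  then obtain u where u: "0 \<le> u" "u \<le> 1" and y: "y = (1 - u) *\<^sub>R 1 + u *\<^sub>R x"
    by (auto simp: closed_segment_def)
  show "y \<in> {z. Im z \<noteq> 0 \<or> Re z > d}"
  proof (cases "Im x = 0")
    case True
    then have re: "Re x > d" using x by simp
    have "convex {d<..}" by simp
    from convexD[OF this, of 1 "Re x" "1 - u" u] re assms u
    have "(1 - u) *\<^sub>R 1 + u *\<^sub>R Re x > d" by auto
    then show ?thesis by (simp add: y)
  next
    case False
    then show ?thesis using assms by (cases "u = 0") (auto simp: y)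
  qed
qed

lemma exp_minus_one_quotient_tendsto: "((\<lambda>z::complex. (exp z - 1) / z) \<longlongrightarrow> 1) (at 0)"
  using DERIV_exp[of "0::complex"] by (simp add: has_field_derivative_iff)

text \<open>A real integrand has a real integral over a real segment. Pieces of the real axis may
  thus be added to a contour without changing the imaginary part.\<close>

lemma Im_primitive_const_on_real_segment:
  assumes "a \<le> b"
    and der: "\<And>x. a \<le> x \<Longrightarrow> x \<le> b \<Longrightarrow> (F has_field_derivative f (complex_of_real x)) (at (complex_of_real x))"
    and real: "\<And>x. a \<le> x \<Longrightarrow> x \<le> b \<Longrightarrow> Im (f (complex_of_real x)) = 0"
  shows "Im (F (complex_of_real b)) = Im (F (complex_of_real a))"
proof -
  have *: "((\<lambda>x. Im (F (complex_of_real x))) has_vector_derivative 0) (at x within {a..b})"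
    if x: "x \<in> {a..b}" for x
  proof -
    have "((F \<circ> complex_of_real) has_vector_derivative (1 * f (complex_of_real x))) (at x)"
      by (rule field_vector_diff_chain_at)
        (use der x in \<open>auto intro!: derivative_eq_intros has_vector_derivative_of_real\<close>)
    then have "((\<lambda>x. Im (F (complex_of_real x))) has_vector_derivative Im (f (complex_of_real x))) (at x)"
      by (simp add: has_vector_derivative_complex_iff has_real_derivative_iff_has_vector_derivative o_def)
    then show ?thesis
      using real x by (auto intro: has_vector_derivative_at_within)
  qed
  obtain e where "\<And>x. x \<in> {a..b} \<Longrightarrow> Im (F (complex_of_real x)) = e"
    using has_vector_derivative_zero_constant[of "{a..b}" "\<lambda>x. Im (F (complex_of_real x))",
        OF convex_real_interval(5) *] by blast
  then show ?thesis using assms(1) by simp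
qed

section \<open>The transform \<open>phi\<close>, the inversion kernel and their primitives\<close>

locale quadratic_form_transform =
  fixes c :: "'i \<Rightarrow> real" and I :: "'i set"
  assumes finI: "finite I" and neI: "I \<noteq> {}" and cpos: "\<And>k. k \<in> I \<Longrightarrow> c k > 0"
begin

text \<open>The Laplace transform of Y, with \<open>c k = 2 * a k\<close>. The roots are taken
  factor by factor: the principal root of the product would jump where the arguments of the factors
  add up to pi.\<close>

definition phi :: "complex \<Rightarrow> complex" where
  "phi z = 1 / (\<Prod>k\<in>I. csqrt (1 + complex_of_real (c k) * z))"

text \<open>The integrand of Levy's formula for the interval (0, 1], read at
  \<open>z = - \<i> * t\<close>, with its removable singularity at 0 filled in by the limit.\<close>

definition kern :: "complex \<Rightarrow> complex" where
  "kern z = phi z * (if z = 0 then 1 else (exp z - 1) / z)"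

\<comment> \<open>A lower bound for every \<open>1 / c k\<close>, so that the branch points \<open>- 1 / c k\<close> lie outside \<open>slit delta\<close>.\<close>
definition delta :: real where "delta = 1 / (\<Sum>k\<in>I. c k)"

text \<open>The plane cut along the reals up to \<open>- d\<close>. For \<open>d = delta\<close> it
  contains 0 and avoids the branch points; for \<open>d = 0\<close> the cut also swallows the pole
  of \<open>phi z / z\<close>.\<close>

definition slit :: "real \<Rightarrow> complex set" where
  "slit d = {z. Im z \<noteq> 0 \<or> Re z > - d}"

lemma sum_c_pos: "(\<Sum>k\<in>I. c k) > 0"
  using finI neI cpos by (intro sum_pos) auto

lemma delta_pos: "delta > 0"
  unfolding delta_def using sum_c_pos by simp

lemma factor_slit:
  assumes "k \<in> I" "z \<in> slit delta"
  shows "1 + complex_of_real (c k) * z \<notin> \<real>\<^sub>\<le>\<^sub>0"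
proof
  assume "1 + complex_of_real (c k) * z \<in> \<real>\<^sub>\<le>\<^sub>0"
  then have im: "Im z = 0" and re: "1 + c k * Re z \<le> 0"
    using cpos[OF assms(1)] by (auto simp: complex_nonpos_Reals_iff)
  have "Re z > - delta" using assms(2) im by (simp add: slit_def)
  then have "c k * Re z > - (c k * delta)"
    using cpos[OF assms(1)] by (metis mult_minus_right mult_strict_left_mono)
  moreover have "c k \<le> (\<Sum>k\<in>I. c k)"
    using finI assms(1) cpos by (intro member_le_sum) (auto intro: less_imp_le)
  then have "c k * delta \<le> 1"
    using sum_c_pos by (simp add: delta_def)
  ultimately show False using re by simp
qed

lemma prod_nonzero: "z \<in> slit delta \<Longrightarrow> (\<Prod>k\<in>I. csqrt (1 + complex_of_real (c k) * z)) \<noteq> 0"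
  using finI factor_slit by (force simp: prod_zero_iff)

lemma slit_mono: "d \<le> e \<Longrightarrow> slit d \<subseteq> slit e"
  by (auto simp: slit_def)

lemma phi_holomorphic: "phi holomorphic_on slit delta"
  unfolding phi_def using prod_nonzero factor_slit
  by (intro holomorphic_intros) auto

lemma slit_open: "open (slit d)"
  unfolding slit_def by (rule open_slit)

lemma slit_starlike: "d > - 1 \<Longrightarrow> starlike (slit d)"
  unfolding slit_def by (rule starlike_slit) simp

lemma kern_field_differentiable:
  assumes z: "z \<in> slit delta - {0}"
  shows "kern field_differentiable at z"
proof -
  have "(\<lambda>z. phi z * ((exp z - 1) / z)) holomorphic_on (slit delta - {0})"
    by (intro holomorphic_intros holomorphic_on_subset[OF phi_holomorphic]) auto
  then have "kern holomorphic_on (slit delta - {0})"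
    by (rule holomorphic_transform) (auto simp: kern_def)
  then show ?thesis
    using z slit_open by (intro holomorphic_on_imp_differentiable_at[of _ "slit delta - {0}"])
      (auto intro: open_delete)
qed

lemma kern_isCont:
  assumes z: "z \<in> slit delta"
  shows "isCont kern z"
proof (cases "z = 0")
  case True
  have "isCont phi 0"
    using holomorphic_on_imp_differentiable_at[OF phi_holomorphic slit_open] z True
      field_differentiable_imp_continuous_at by blast
  then have "((\<lambda>z. phi z * ((exp z - 1) / z)) \<longlongrightarrow> phi 0 * 1) (at 0)"
    by (intro tendsto_mult exp_minus_one_quotient_tendsto) (simp add: isCont_def)
  then have "(kern \<longlongrightarrow> phi 0 * 1) (at 0)"
    by (rule Lim_transform_eventually) (auto simp: kern_def eventually_at_filter)
  then show ?thesis by (simp add: True isCont_def) (simp add: kern_def)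
next
  case False
  then show ?thesis using kern_field_differentiable z field_differentiable_imp_continuous_at by blast
qed

text \<open>The primitive theorem for starlike domains allows finitely many points at which the
  function is merely continuous, so differentiability of \<open>kern\<close> at 0 does not have to
  be shown.\<close>

lemma kern_primitive:
  obtains K where "\<And>z. z \<in> slit delta \<Longrightarrow> (K has_field_derivative kern z) (at z)"
proof -
  have cont: "continuous_on (slit delta) kern"
    by (intro continuous_at_imp_continuous_on ballI kern_isCont)
  have "\<exists>K. \<forall>z\<in>slit delta. (K has_field_derivative kern z) (at z)"
    by (rule holomorphic_starlike_primitive[OF cont slit_starlike slit_open, of "{0}"])
      (use kern_field_differentiable delta_pos in auto)
  then show ?thesis using that by blast
qed

lemma phi_div_primitive:
  obtains L where "\<And>z. z \<in> slit 0 \<Longrightarrow> (L has_field_derivative phi z / z) (at z)"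
proof -
  have hol: "(\<lambda>z. phi z / z) holomorphic_on slit 0"
    using slit_mono[of 0 delta] delta_pos
    by (intro holomorphic_intros holomorphic_on_subset[OF phi_holomorphic]) (auto simp: slit_def)
  have "\<exists>L. \<forall>z\<in>slit 0. (L has_field_derivative phi z / z) (at z)"
    by (rule holomorphic_starlike_primitive[OF holomorphic_on_imp_continuous_on[OF hol] slit_starlike slit_open, of "{}"])
      (use holomorphic_on_imp_differentiable_at[OF hol slit_open] in auto)
  then show ?thesis using that by blast
qed

lemma phi_of_real:
  assumes "x \<ge> 0"
  shows "phi (complex_of_real x) = complex_of_real (1 / (\<Prod>k\<in>I. sqrt (1 + c k * x)))"
proof -
  have "csqrt (1 + complex_of_real (c k) * complex_of_real x) = complex_of_real (sqrt (1 + c k * x))"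
    if "k \<in> I" for k
  proof -
    have "1 + c k * x \<ge> 0" using cpos[OF that] assms by simp
    then show ?thesis
      using csqrt_of_real_nonneg[of "complex_of_real (1 + c k * x)"] by simp
  qed
  then show ?thesis by (simp add: phi_def)
qed

lemma phi_cnj:
  assumes "z \<in> slit delta"
  shows "phi (cnj z) = cnj (phi z)"
  using factor_slit[OF _ assms] by (simp add: phi_def cnj_csqrt)

lemma kern_cnj:
  assumes "z \<in> slit delta"
  shows "kern (cnj z) = cnj (kern z)"
  using phi_cnj[OF assms] by (simp add: kern_def exp_cnj)

section \<open>Decay of the transform and of primitive differences far out\<close>

definition phi_const :: real where "phi_const = (\<Prod>k\<in>I. 1 / sqrt (c k))"

lemma phi_const_nonneg: "phi_const \<ge> 0"
  unfolding phi_const_def using cpos by (intro prod_nonneg) (auto intro: less_imp_le)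

text \<open>As \<open>c k > 0\<close>, each radicand has real or imaginary part at least
  \<open>c k * T\<close>. The constant is the limit of
  \<open>norm (phi z) * norm z powr (card I / 2)\<close> at infinity.\<close>

lemma norm_phi_le:
  assumes T: "T \<ge> 1" and z: "Re z \<ge> T \<or> Im z \<ge> T"
  shows "norm (phi z) \<le> phi_const / sqrt T"
proof -
  have factor: "norm (1 / csqrt (1 + complex_of_real (c k) * z)) \<le> 1 / sqrt (c k) * (1 / sqrt T)"
    if k: "k \<in> I" for k
  proof -
    have "c k * T \<le> norm (1 + complex_of_real (c k) * z)"
    proof (cases "Re z \<ge> T")
      case True
      then have "c k * T \<le> Re (1 + complex_of_real (c k) * z)"
        using mult_left_mono[of T "Re z" "c k"] less_imp_le[OF cpos[OF k]] by (simp del: mult_le_cancel_left_pos)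
      then show ?thesis using complex_Re_le_cmod order_trans by blast
    next
      case False
      then have "c k * T \<le> Im (1 + complex_of_real (c k) * z)"
        using mult_left_mono[of T "Im z" "c k"] cpos[OF k] z by simp
      then show ?thesis using abs_Im_le_cmod[of "1 + complex_of_real (c k) * z"] by linarith
    qed
    then have "sqrt (c k * T) \<le> norm (csqrt (1 + complex_of_real (c k) * z))"
      by (simp add: norm_csqrt)
    moreover have "sqrt (c k * T) > 0" using cpos[OF k] T by simp
    ultimately have "1 / norm (csqrt (1 + complex_of_real (c k) * z)) \<le> 1 / sqrt (c k * T)"
      by (intro frac_le) auto
    then show ?thesis by (simp add: norm_divide real_sqrt_mult)
  qed
  have "norm (phi z) = (\<Prod>k\<in>I. norm (1 / csqrt (1 + complex_of_real (c k) * z)))"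
    by (simp add: phi_def norm_divide prod_norm[symmetric] prod_dividef)
  also have "\<dots> \<le> (\<Prod>k\<in>I. 1 / sqrt (c k) * (1 / sqrt T))"
    by (rule prod_mono) (use factor in auto)
  also have "\<dots> = phi_const * (1 / sqrt T) ^ card I"
    by (simp add: phi_const_def prod.distrib prod_dividef power_divide)
  \<comment> \<open>Since \<open>T >= 1\<close>, all but one of the factors
    \<open>1 / sqrt T\<close> may be dropped; one exists because \<open>I\<close> is nonempty. The
    exponent 1/2 is the worst case \<open>card I = 1\<close>.\<close>
  also have "\<dots> \<le> phi_const * (1 / sqrt T) ^ 1"
    using finI neI T phi_const_nonneg
    by (intro mult_left_mono power_decreasing) (auto simp: Suc_le_eq card_gt_0_iff)
  finally show ?thesis by simp
qed

text \<open>Mean value bound for the horizontal segment joining the ray to the imaginary axis. The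
  condition \<open>Re z <= 1\<close> holds on both and keeps \<open>exp z\<close> bounded by
  \<open>exp 1\<close>.\<close>

lemma kern_primitive_tail:
  assumes K: "\<And>z. z \<in> slit delta \<Longrightarrow> (K has_field_derivative kern z) (at z)"
    and T: "T \<ge> 1" and x: "Re x \<le> 1" "Im x \<ge> T" and y: "Re y \<le> 1" "Im y \<ge> T"
  shows "norm (K x - K y) \<le> phi_const / sqrt T * ((exp 1 + 1) / T) * norm (x - y)"
proof (rule field_differentiable_bound)
  let ?A = "{z. Re z \<le> 1} \<inter> {z. Im z \<ge> T}"
  show "convex ?A" by (intro convex_Int convex_halfspace_Re_le convex_halfspace_Im_ge)
  show "x \<in> ?A" "y \<in> ?A" using x y by auto
  fix z assume z: "z \<in> ?A"
  then have "z \<in> slit delta" using T by (auto simp: slit_def)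
  then show "(K has_field_derivative kern z) (at z within ?A)"
    using K has_field_derivative_at_within by blast
  have z0: "z \<noteq> 0" using z T by auto
  have nz: "T \<le> norm z" using z abs_Im_le_cmod[of z] by auto
  have "norm (exp z - 1) \<le> norm (exp z) + norm (1::complex)" by (rule norm_triangle_ineq4)
  also have "\<dots> \<le> exp 1 + 1" using z by simp
  finally have "norm ((exp z - 1) / z) \<le> (exp 1 + 1) / T"
    unfolding norm_divide by (rule frac_le[rotated]) (use nz T in \<open>auto intro: add_nonneg_nonneg\<close>)
  moreover have "norm (phi z) \<le> phi_const / sqrt T"
    by (rule norm_phi_le) (use z T in auto)
  ultimately show "norm (kern z) \<le> phi_const / sqrt T * ((exp 1 + 1) / T)"
    using z0 T phi_const_nonneg unfolding kern_def norm_mult by (intro mult_mono) auto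
qed

text \<open>Without the exponential the real part may grow, so this contour can escape to the right.
  The region with \<open>Re z >= T\<close> or \<open>Im z >= T\<close> is not convex, so the mean
  value bound is applied in each half-plane separately.\<close>

lemma phi_div_primitive_tail:
  assumes L: "\<And>z. z \<in> slit 0 \<Longrightarrow> (L has_field_derivative phi z / z) (at z)"
    and T: "T \<ge> 1" and xy: "(Re x \<ge> T \<and> Re y \<ge> T) \<or> (Im x \<ge> T \<and> Im y \<ge> T)"
  shows "norm (L x - L y) \<le> phi_const / sqrt T * (1 / T) * norm (x - y)"
proof -
  have *: "norm (L x - L y) \<le> phi_const / sqrt T * (1 / T) * norm (x - y)"
    if A: "convex A" "x \<in> A" "y \<in> A" "\<And>z. z \<in> A \<Longrightarrow> Re z \<ge> T \<or> Im z \<ge> T" for A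
  proof (rule field_differentiable_bound[OF A(1) _ _ A(2,3)])
    fix z assume "z \<in> A"
    then have z: "Re z \<ge> T \<or> Im z \<ge> T" using A(4) by blast
    then have "z \<in> slit 0" using T by (auto simp: slit_def)
    then show "(L has_field_derivative phi z / z) (at z within A)"
      using L has_field_derivative_at_within by blast
    have nz: "T \<le> norm z" using z abs_Im_le_cmod[of z] abs_Re_le_cmod[of z] by linarith
    have "norm (phi z / z) = norm (phi z) * (1 / norm z)" by (simp add: norm_divide)
    also have "\<dots> \<le> phi_const / sqrt T * (1 / T)"
      using nz T phi_const_nonneg
      by (intro mult_mono norm_phi_le z divide_left_mono) (auto intro!: mult_pos_pos)
    finally show "norm (phi z / z) \<le> phi_const / sqrt T * (1 / T)" .
  qed
  from xy show ?thesis
  proof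
    assume "Re x \<ge> T \<and> Re y \<ge> T"
    then show ?thesis by (intro *[of "{z. Re z \<ge> T}"] convex_halfspace_Re_ge) auto
  next
    assume "Im x \<ge> T \<and> Im y \<ge> T"
    then show ?thesis by (intro *[of "{z. Im z \<ge> T}"] convex_halfspace_Im_ge) auto
  qed
qed

section \<open>Levy's integral in terms of the primitive on the imaginary axis\<close>

lemma imaginary_axis_derivative:
  assumes K: "\<And>z. z \<in> slit delta \<Longrightarrow> (K has_field_derivative kern z) (at z)"
    and w: "Re w = 0"
  shows "((\<lambda>t. K (w * complex_of_real t)) has_vector_derivative w * kern (w * complex_of_real t)) (at t)"
proof -
  have "((\<lambda>t. w * complex_of_real t) has_vector_derivative w) (at t)"
    by (auto intro!: derivative_eq_intros has_vector_derivative_of_real)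
  moreover have "w * complex_of_real t \<in> slit delta"
    using w delta_pos by (simp add: slit_def)
  ultimately show ?thesis
    using field_vector_diff_chain_at[of "\<lambda>t. w * complex_of_real t" w t K] K unfolding o_def by blast
qed

text \<open>Schwarz reflection: \<open>kern\<close> commutes with conjugation, so both terms have
  the same derivative in T. The constant remains because \<open>K 0\<close> need not be
  real.\<close>

lemma imaginary_axis_reflect:
  assumes K: "\<And>z. z \<in> slit delta \<Longrightarrow> (K has_field_derivative kern z) (at z)"
  shows "K (- \<i> * complex_of_real T) - cnj (K (\<i> * complex_of_real T)) = K 0 - cnj (K 0)"
proof -
  let ?G = "\<lambda>t. K (- \<i> * complex_of_real t) - cnj (K (\<i> * complex_of_real t))"
  have *: "(?G has_vector_derivative 0) (at t within UNIV)" for t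
  proof -
    have "\<i> * complex_of_real t \<in> slit delta"
      using delta_pos by (simp add: slit_def)
    from kern_cnj[OF this] have "kern (- \<i> * complex_of_real t) = cnj (kern (\<i> * complex_of_real t))"
      by simp
    moreover have "(?G has_vector_derivative
        (- \<i> * kern (- \<i> * complex_of_real t) - cnj (\<i> * kern (\<i> * complex_of_real t)))) (at t)"
      by (intro has_vector_derivative_diff has_vector_derivative_cnj imaginary_axis_derivative K) auto
    ultimately show ?thesis by simp
  qed
  obtain e where "\<And>t. t \<in> UNIV \<Longrightarrow> ?G t = e"
    using has_vector_derivative_zero_constant[of UNIV ?G, OF convex_UNIV *] by blast
  from this[of T] this[of 0] show ?thesis by simp
qed

text \<open>The integral is \<open>\<i>\<close> times the increment of \<open>K\<close> from
  \<open>\<i> * T\<close> to \<open>- \<i> * T\<close>; by reflection the real parts of the two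
  values cancel and the imaginary increments from 0 are opposite.\<close>

lemma inversion_integral_eq:
  assumes K: "\<And>z. z \<in> slit delta \<Longrightarrow> (K has_field_derivative kern z) (at z)"
    and T: "(T::real) \<ge> 0"
  shows "(CLBINT t=ereal (-T)..ereal T. (iexp (-(t * 0)) - iexp (-(t * 1))) / (\<i> * t) * phi (- \<i> * t))
    = complex_of_real (2 * (Im (K (\<i> * T)) - Im (K 0)))"
proof -
  have "(CLBINT t=ereal (-T)..ereal T. (iexp (-(t * 0)) - iexp (-(t * 1))) / (\<i> * t) * phi (- \<i> * t))
      = (CLBINT t:{-T..T}. (iexp (-(t * 0)) - iexp (-(t * 1))) / (\<i> * t) * phi (- \<i> * t))"
    by (rule interval_integral_Icc) (use T in simp)
  also have "\<dots> = (CLBINT t:{-T..T}. kern (- \<i> * complex_of_real t))"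
    unfolding set_lebesgue_integral_def
  \<comment> \<open>At \<open>t = 0\<close> the left integrand is 0 by the convention for division,
    whereas \<open>kern 0\<close> is \<open>phi 0\<close>; a single point does not affect the
    integral.\<close>
  proof (rule integral_discrete_difference[of "{0}"])
    fix t :: real assume "t \<notin> {0}"
    then have t: "t \<noteq> 0" by simp
    define w where "w = - \<i> * complex_of_real t"
    have "iexp (-(t * 0)) - iexp (-(t * 1)) = - (exp w - 1)" and i: "\<i> * complex_of_real t = - w"
      by (simp_all add: w_def)
    then have "(iexp (-(t * 0)) - iexp (-(t * 1))) / (\<i> * t) = (exp w - 1) / w"
      by (simp only: minus_divide_divide)
    moreover have "kern w = phi w * ((exp w - 1) / w)"
      using t by (simp add: kern_def w_def)
    ultimately have "(iexp (-(t * 0)) - iexp (-(t * 1))) / (\<i> * t) * phi (- \<i> * t)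
        = kern (- \<i> * complex_of_real t)"
      by (simp only: w_def mult.commute)
    then show "indicator {-T..T} t *\<^sub>R ((iexp (-(t * 0)) - iexp (-(t * 1))) / (\<i> * t) * phi (- \<i> * t))
        = indicator {-T..T} t *\<^sub>R kern (- \<i> * complex_of_real t)"
      by (simp only:)
  qed simp_all
  also have "\<dots> = (CLBINT t=ereal (-T)..ereal T. kern (- \<i> * complex_of_real t))"
    by (rule interval_integral_Icc[symmetric]) (use T in simp)
  also have "\<dots> = \<i> * K (- \<i> * complex_of_real T) - \<i> * K (- \<i> * complex_of_real (- T))"
  proof (rule interval_integral_FTC_finite)
    show "continuous_on {min (- T) T..max (- T) T} (\<lambda>t. kern (- \<i> * complex_of_real t))"
    proof (rule continuous_at_imp_continuous_on, rule ballI)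
      fix t :: real
      have "- \<i> * complex_of_real t \<in> slit delta" using delta_pos by (simp add: slit_def)
      then have "isCont kern (- \<i> * complex_of_real t)" by (rule kern_isCont)
      moreover have "isCont (\<lambda>t. - \<i> * complex_of_real t) t" by (intro continuous_intros)
      ultimately show "isCont (\<lambda>t. kern (- \<i> * complex_of_real t)) t"
        by (rule isCont_o2[rotated])
    qed
    fix t
    have "((\<lambda>t. K (- \<i> * complex_of_real t)) has_vector_derivative
        - \<i> * kern (- \<i> * complex_of_real t)) (at t)"
      by (rule imaginary_axis_derivative[OF K]) simp_all
    from has_vector_derivative_mult_right[OF this, of \<i>]
    have "((\<lambda>t. \<i> * K (- \<i> * complex_of_real t)) has_vector_derivative
        kern (- \<i> * complex_of_real t)) (at t)" by simp
    then show "((\<lambda>t. \<i> * K (- \<i> * complex_of_real t)) has_vector_derivative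
        kern (- \<i> * complex_of_real t)) (at t within {min (- T) T..max (- T) T})"
      by (rule has_vector_derivative_at_within)
  qed
  also have "\<dots> = complex_of_real (2 * (Im (K (\<i> * T)) - Im (K 0)))"
  proof -
    have "Re (K (- \<i> * complex_of_real T)) = Re (K (\<i> * complex_of_real T))"
      "Im (K (- \<i> * complex_of_real T)) + Im (K (\<i> * complex_of_real T)) = 2 * Im (K 0)"
      using arg_cong[OF imaginary_axis_reflect[OF K, of T], of Re]
        arg_cong[OF imaginary_axis_reflect[OF K, of T], of Im] by simp_all
    then show ?thesis by (intro complex_eqI) simp_all
  qed
  finally show ?thesis .
qed

end

text \<open>The functional \<open>Re w + Im w / r\<close> is constantly 1 along the ray and \<open>1 + c k\<close> along its image
  under \<open>z \<mapsto> 1 + c k * z\<close>, which keeps the ray away from the pole and the branch points.\<close>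

lemma norm_ge_ray_functional:
  assumes "r > 0" and "Re w + Im w / r \<ge> b"
  shows "b / (1 + 1 / r) \<le> norm w"
proof -
  have "Im w / r \<le> norm w / r"
    using abs_Im_le_cmod[of w] assms(1) by (intro divide_right_mono) auto
  then have "b \<le> norm w * (1 + 1 / r)"
    using assms(2) complex_Re_le_cmod[of w] by (simp add: distrib_left)
  moreover have "1 + 1 / r > 0" using assms(1) by (simp add: add_pos_pos)
  ultimately show ?thesis by (simp only: pos_divide_le_eq)
qed

section \<open>The integrand on the ray: form, decay and primitive\<close>

context quadratic_form_transform
begin

definition ray :: "real \<Rightarrow> real \<Rightarrow> complex" where
  "ray r t = complex_of_real (1 - t) + \<i> * complex_of_real (t * r)"

definition ray_integrand :: "real \<Rightarrow> real \<Rightarrow> complex" where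
  "ray_integrand r t = exp (complex_of_real (1 - t)) * exp (\<i> * complex_of_real (t * r)) /
     (complex_of_real pi * (complex_of_real t - 1 / (1 - \<i> * complex_of_real r)) *
      (\<Prod>k\<in>I. csqrt (1 + complex_of_real (c k) * ray r t)))"

lemma Re_ray [simp]: "Re (ray r t) = 1 - t" and Im_ray [simp]: "Im (ray r t) = t * r"
  by (simp_all add: ray_def)

lemma ray_in_slit: "r > 0 \<Longrightarrow> t \<ge> 0 \<Longrightarrow> ray r t \<in> slit 0"
  by (cases "t = 0") (auto simp: slit_def)

lemma ray_nonzero:
  assumes "r > 0"
  shows "ray r t \<noteq> 0"
proof
  assume "ray r t = 0"
  then have "Re (ray r t) = 0" "Im (ray r t) = 0" by simp_all
  then have "1 - t = 0" "t * r = 0" by (simp_all only: Re_ray Im_ray)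
  then show False using assms by simp
qed

text \<open>The factor \<open>- 1 + \<i> * r\<close> is the derivative of \<open>ray r\<close>, so
  the integrand is the pullback of \<open>exp z * phi z / z\<close> dz to the ray, divided by
  pi.\<close>

lemma ray_integrand_eq:
  "ray_integrand r t = complex_of_real (1 / pi) *
     ((- 1 + \<i> * complex_of_real r) * (exp (ray r t) * (phi (ray r t) / ray r t)))"
proof -
  define a where "a = 1 - \<i> * complex_of_real r"
  define P where "P = (\<Prod>k\<in>I. csqrt (1 + complex_of_real (c k) * ray r t))"
  have a: "a \<noteq> 0" by (auto simp: a_def complex_eq_iff)
  have "ray r t = 1 - complex_of_real t * a"
    by (simp add: ray_def a_def algebra_simps)
  then have "ray r t / a = 1 / a - complex_of_real t"
    using a by (simp add: diff_divide_distrib)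
  then have t: "complex_of_real t - 1 / a = - (ray r t / a)" by simp
  have "exp (complex_of_real (1 - t)) * exp (\<i> * complex_of_real (t * r)) = exp (ray r t)"
    by (simp only: ray_def exp_add)
  then have "ray_integrand r t = exp (ray r t) / (complex_of_real pi * (complex_of_real t - 1 / a) * P)"
    unfolding ray_integrand_def a_def P_def by (simp only:)
  also have "\<dots> = exp (ray r t) / (complex_of_real pi * - (ray r t / a) * P)"
    by (simp only: t)
  also have "\<dots> = complex_of_real (1 / pi) * (- a * (exp (ray r t) * (1 / P / ray r t)))"
    by (simp add: mult_ac)
  finally show ?thesis by (simp only: a_def P_def phi_def minus_diff_eq) (simp add: algebra_simps)
qed

lemma norm_phi_ray_le:
  assumes r: "r > 0"
  shows "norm (phi (ray r t)) \<le> sqrt (1 + 1 / r) ^ card I"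
proof -
  have pos: "1 + 1 / r > 0" using r by (simp add: add_pos_pos)
  have "norm (1 / csqrt (1 + complex_of_real (c k) * ray r t)) \<le> sqrt (1 + 1 / r)" if k: "k \<in> I" for k
  proof -
    have "1 / (1 + 1 / r) \<le> norm (1 + complex_of_real (c k) * ray r t)"
    proof (rule norm_ge_ray_functional[OF r])
      have "c k * (t * r) / r = c k * t" using r by simp
      then have "Re (1 + complex_of_real (c k) * ray r t) + Im (1 + complex_of_real (c k) * ray r t) / r
          = 1 + c k"
        by (simp add: algebra_simps)
      then show "Re (1 + complex_of_real (c k) * ray r t) + Im (1 + complex_of_real (c k) * ray r t) / r \<ge> 1"
        using cpos[OF k] by linarith
    qed
    then have "sqrt (1 / (1 + 1 / r)) \<le> norm (csqrt (1 + complex_of_real (c k) * ray r t))"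
      by (simp only: norm_csqrt real_sqrt_le_iff)
    then have "1 / norm (csqrt (1 + complex_of_real (c k) * ray r t)) \<le> 1 / sqrt (1 / (1 + 1 / r))"
      using pos by (intro frac_le) auto
    then show ?thesis by (simp add: norm_divide real_sqrt_divide)
  qed
  then have "(\<Prod>k\<in>I. norm (1 / csqrt (1 + complex_of_real (c k) * ray r t))) \<le> (\<Prod>k\<in>I. sqrt (1 + 1 / r))"
    by (intro prod_mono) auto
  moreover have "norm (phi (ray r t)) = (\<Prod>k\<in>I. norm (1 / csqrt (1 + complex_of_real (c k) * ray r t)))"
    by (simp add: phi_def norm_divide prod_norm[symmetric] prod_dividef)
  ultimately show ?thesis by simp
qed

text \<open>All decay comes from \<open>norm (exp (ray r t)) = exp (1 - t)\<close>;
  \<open>phi\<close> and the reciprocal of z need only be bounded along the ray.\<close>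

lemma norm_ray_integrand_le:
  assumes r: "r > 0"
  shows "norm (ray_integrand r t) \<le>
    (1 / pi * (norm (- 1 + \<i> * complex_of_real r) * (exp 1 * (sqrt (1 + 1 / r) ^ card I * (1 + 1 / r))))) * exp (- t)"
proof -
  have pos: "1 + 1 / r > 0" using r by (simp add: add_pos_pos)
  have "1 / (1 + 1 / r) \<le> norm (ray r t)"
    by (rule norm_ge_ray_functional[OF r]) (use r in simp)
  then have "1 / norm (ray r t) \<le> 1 / (1 / (1 + 1 / r))"
    using pos by (intro frac_le) auto
  then have inv: "1 / norm (ray r t) \<le> 1 + 1 / r" by simp
  have "norm (phi (ray r t) / ray r t) = norm (phi (ray r t)) * (1 / norm (ray r t))"
    by (simp add: norm_divide)
  also have "\<dots> \<le> sqrt (1 + 1 / r) ^ card I * (1 + 1 / r)"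
    by (intro mult_mono norm_phi_ray_le r inv) (use pos in auto)
  finally have quot: "norm (phi (ray r t) / ray r t) \<le> sqrt (1 + 1 / r) ^ card I * (1 + 1 / r)" .
  have "norm (ray_integrand r t)
      = (1 / pi) * (norm (- 1 + \<i> * complex_of_real r) * (exp (1 - t) * norm (phi (ray r t) / ray r t)))"
    unfolding ray_integrand_eq by (simp only: norm_mult norm_exp_eq_Re Re_ray norm_of_real abs_of_pos) simp
  also have "\<dots> \<le> (1 / pi) * (norm (- 1 + \<i> * complex_of_real r) * (exp (1 - t) *
      (sqrt (1 + 1 / r) ^ card I * (1 + 1 / r))))"
    by (intro mult_left_mono quot) auto
  also have "exp (1 - t) = exp 1 * exp (- t)"
    using exp_add[of 1 "- t"] by simp
  finally show ?thesis by (simp only: mult_ac)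
qed

lemma continuous_on_ray_integrand:
  assumes r: "r > 0"
  shows "continuous_on {0..} (ray_integrand r)"
proof -
  have ray: "continuous_on {0..} (ray r)"
    unfolding ray_def[abs_def] by (intro continuous_intros)
  have sub: "ray r ` {0..} \<subseteq> slit delta"
    using ray_in_slit[OF r] slit_mono[of 0 delta] delta_pos by auto
  have "continuous_on {0..} (\<lambda>t. phi (ray r t))"
    by (rule continuous_on_compose2[OF holomorphic_on_imp_continuous_on[OF phi_holomorphic] ray sub])
  moreover have "\<forall>t\<in>{0..}. ray r t \<noteq> 0"
    using ray_nonzero[OF r] by blast
  ultimately show ?thesis
    unfolding ray_integrand_eq[abs_def] by (intro continuous_intros ray) auto
qed

lemma set_integrable_ray_integrand:
  assumes r: "r > 0"
  shows "set_integrable lborel {0..} (ray_integrand r)"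
proof -
  define B where "B = 1 / pi * (norm (- 1 + \<i> * complex_of_real r) *
    (exp 1 * (sqrt (1 + 1 / r) ^ card I * (1 + 1 / r))))"
  have "integrable lborel (\<lambda>t. exp (- t) * indicator {0..} t :: real)"
    using has_bochner_integral_I0i_power_exp_m'[of 0] by (simp add: integrable.intros)
  then have "set_integrable lborel {0..} (\<lambda>t. exp (- t) :: real)"
    by (simp add: set_integrable_def mult.commute)
  then have "set_integrable lborel {0..} (\<lambda>t. B * exp (- t))"
    by (rule set_integrable_mult_right)
  then show ?thesis
  proof (rule set_integrable_bound)
    show "set_borel_measurable lborel {0..} (ray_integrand r)"
      unfolding set_borel_measurable_def
      using borel_measurable_continuous_on_indicator[OF _ continuous_on_ray_integrand[OF r]] by simp
    have "norm (ray_integrand r t) \<le> norm (B * exp (- t))" for t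
      using norm_ray_integrand_le[OF r, of t] unfolding B_def[symmetric]
      by (rule order_trans) simp
    then show "AE t in lborel. t \<in> {0..} \<longrightarrow> norm (ray_integrand r t) \<le> norm (B * exp (- t))"
      by (intro AE_I2 impI)
  qed
qed

text \<open>Away from 0 the \<open>- 1\<close> in \<open>kern\<close> is undone by adding
  \<open>phi z / z\<close>, so \<open>K + L\<close> is a primitive of
  \<open>exp z * phi z / z\<close> along the ray.\<close>

lemma ray_integrand_primitive:
  assumes K: "\<And>z. z \<in> slit delta \<Longrightarrow> (K has_field_derivative kern z) (at z)"
    and L: "\<And>z. z \<in> slit 0 \<Longrightarrow> (L has_field_derivative phi z / z) (at z)"
    and r: "r > 0" and t: "t \<ge> 0"
  shows "((\<lambda>t. complex_of_real (1 / pi) * (K (ray r t) + L (ray r t))) has_vector_derivative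
           ray_integrand r t) (at t)"
proof -
  let ?z = "ray r t"
  have z: "?z \<in> slit 0" by (rule ray_in_slit[OF r t])
  then have z': "?z \<in> slit delta" using slit_mono[of 0 delta] delta_pos by auto
  have z0: "?z \<noteq> 0" by (rule ray_nonzero[OF r])
  have ray: "(ray r has_vector_derivative (- 1 + \<i> * complex_of_real r)) (at t)"
    unfolding has_vector_derivative_complex_iff by (auto intro!: derivative_eq_intros)
  have "((\<lambda>z. K z + L z) has_field_derivative (kern ?z + phi ?z / ?z)) (at ?z)"
    by (intro DERIV_add K L z z')
  from field_vector_diff_chain_at[OF ray this]
  have "((\<lambda>t. K (ray r t) + L (ray r t)) has_vector_derivative
      (- 1 + \<i> * complex_of_real r) * (kern ?z + phi ?z / ?z)) (at t)"
    by (simp only: o_def)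
  from has_vector_derivative_mult_right[OF this, of "complex_of_real (1 / pi)"]
  have "((\<lambda>t. complex_of_real (1 / pi) * (K (ray r t) + L (ray r t))) has_vector_derivative
      complex_of_real (1 / pi) * ((- 1 + \<i> * complex_of_real r) * (kern ?z + phi ?z / ?z))) (at t)" .
  moreover have "kern ?z + phi ?z / ?z = exp ?z * (phi ?z / ?z)"
    using z0 by (simp add: kern_def field_simps)
  ultimately show ?thesis by (simp only: ray_integrand_eq)
qed

text \<open>The nested indicators are the form in which \<open>tendsto_integral_at_top\<close>
  truncates an integral.\<close>

lemma ray_integral_partial:
  assumes K: "\<And>z. z \<in> slit delta \<Longrightarrow> (K has_field_derivative kern z) (at z)"
    and L: "\<And>z. z \<in> slit 0 \<Longrightarrow> (L has_field_derivative phi z / z) (at z)"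
    and r: "r > 0" and s: "s \<ge> 0"
  shows "(CLBINT t. indicator {..s} t *\<^sub>R (indicator {0..} t *\<^sub>R ray_integrand r t))
    = complex_of_real (1 / pi) * (K (ray r s) + L (ray r s)) - complex_of_real (1 / pi) * (K 1 + L 1)"
proof -
  have "(CLBINT t. indicator {..s} t *\<^sub>R (indicator {0..} t *\<^sub>R ray_integrand r t))
      = (CLBINT t:{0..s}. ray_integrand r t)"
    unfolding set_lebesgue_integral_def
    by (rule Bochner_Integration.integral_cong) (simp_all split: split_indicator)
  also have "\<dots> = (CLBINT t=ereal 0..ereal s. ray_integrand r t)"
    by (rule interval_integral_Icc[symmetric]) (use s in simp)
  also have "\<dots> = complex_of_real (1 / pi) * (K (ray r s) + L (ray r s))
      - complex_of_real (1 / pi) * (K (ray r 0) + L (ray r 0))"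
  proof (rule interval_integral_FTC_finite)
    show "continuous_on {min 0 s..max 0 s} (ray_integrand r)"
      by (rule continuous_on_subset[OF continuous_on_ray_integrand[OF r]]) (use s in auto)
    fix t assume "min 0 s \<le> t"
    then have "t \<ge> 0" using s by simp
    with K L r have "((\<lambda>t. complex_of_real (1 / pi) * (K (ray r t) + L (ray r t))) has_vector_derivative
        ray_integrand r t) (at t)"
      by (rule ray_integrand_primitive)
    then show "((\<lambda>t. complex_of_real (1 / pi) * (K (ray r t) + L (ray r t))) has_vector_derivative
        ray_integrand r t) (at t within {min 0 s..max 0 s})"
      by (rule has_vector_derivative_at_within)
  qed
  also have "ray r 0 = 1" by (simp add: ray_def)
  finally show ?thesis .
qed

text \<open>\<open>K\<close> is moved from the ray to the imaginary axis, by a horizontal segment at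
  height T and the real segment from 0 to 1. \<open>L\<close> is led from the ray right to
  \<open>T + \<i> * T\<close>, down to T and back to 1 along the real axis. The real pieces leave
  imaginary parts unchanged; the others have length O(T) and integrand O(T powr (-3/2)).\<close>

lemma contour_difference_bound:
  assumes K: "\<And>z. z \<in> slit delta \<Longrightarrow> (K has_field_derivative kern z) (at z)"
    and L: "\<And>z. z \<in> slit 0 \<Longrightarrow> (L has_field_derivative phi z / z) (at z)"
    and r: "r > 0" and T: "T \<ge> 1"
  shows "\<bar>Im (K (ray r (T / r)) + L (ray r (T / r)) - (K 1 + L 1))
            - (Im (K (\<i> * complex_of_real T)) - Im (K 0))\<bar>
    \<le> phi_const * ((exp 1 + 1) * (1 + 1 / r) + (1 + 1 / r) + 1) / sqrt T"
proof -
  \<comment> \<open>The parameter \<open>T / r\<close> puts \<open>?z\<close> at height T, level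
    with \<open>?w\<close> and \<open>?v\<close>; \<open>?u\<close> lies vertically below
    \<open>?v\<close>.\<close>
  let ?z = "ray r (T / r)" and ?w = "\<i> * complex_of_real T"
  let ?v = "complex_of_real T + \<i> * complex_of_real T" and ?u = "complex_of_real T"
  have T0: "T > 0" using T by simp
  have Imz: "Im ?z = T" using r by simp
  have "Im (K (complex_of_real 1)) = Im (K (complex_of_real 0))"
  proof (rule Im_primitive_const_on_real_segment)
    fix x :: real assume x: "0 \<le> x"
    show "(K has_field_derivative kern (complex_of_real x)) (at (complex_of_real x))"
      using x delta_pos by (intro K) (simp add: slit_def)
    have "kern (complex_of_real x) = complex_of_real
        (1 / (\<Prod>k\<in>I. sqrt (1 + c k * x)) * (if x = 0 then 1 else (exp x - 1) / x))"
      using x by (simp add: kern_def phi_of_real exp_of_real[symmetric])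
    then show "Im (kern (complex_of_real x)) = 0" by (simp only: Im_complex_of_real)
  qed simp
  then have K1: "Im (K 1) = Im (K 0)" by simp
  have "Im (L ?u) = Im (L (complex_of_real 1))"
  proof (rule Im_primitive_const_on_real_segment[OF T])
    fix x :: real assume x: "1 \<le> x"
    show "(L has_field_derivative phi (complex_of_real x) / complex_of_real x) (at (complex_of_real x))"
      using x by (intro L) (simp add: slit_def)
    have "phi (complex_of_real x) / complex_of_real x
        = complex_of_real (1 / (\<Prod>k\<in>I. sqrt (1 + c k * x)) / x)"
      using x by (simp add: phi_of_real)
    then show "Im (phi (complex_of_real x) / complex_of_real x) = 0" by (simp only: Im_complex_of_real)
  qed
  then have L1: "Im (L 1) = Im (L ?u)" by simp
  have len1: "norm (?z - ?w) \<le> T * (1 + 1 / r)"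
  proof -
    have "?z - ?w = complex_of_real (1 - T / r)" using r by (simp add: ray_def)
    then have "norm (?z - ?w) = \<bar>1 - T / r\<bar>" by (simp only: norm_of_real)
    also have "\<dots> \<le> T * (1 + 1 / r)"
      using T divide_pos_pos[OF T0 r] by (auto simp: abs_le_iff distrib_left)
    finally show ?thesis .
  qed
  have len2: "norm (?z - ?v) \<le> T * (1 + 1 / r)"
  proof -
    have "?z - ?v = complex_of_real (1 - T / r - T)" using r by (simp add: ray_def)
    then have "norm (?z - ?v) = \<bar>1 - T / r - T\<bar>" by (simp only: norm_of_real)
    also have "\<dots> \<le> T * (1 + 1 / r)"
      using T divide_pos_pos[OF T0 r] by (auto simp: abs_le_iff distrib_left)
    finally show ?thesis .
  qed
  have len3: "norm (?v - ?u) \<le> T" using T0 by (simp add: norm_mult)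
  have C0: "phi_const / sqrt T * q \<ge> 0" if "q \<ge> 0" for q
    using that phi_const_nonneg T0 by simp
  have "norm (K ?z - K ?w) \<le> phi_const / sqrt T * ((exp 1 + 1) / T) * norm (?z - ?w)"
    by (rule kern_primitive_tail[OF K T]) (use T0 r Imz in simp_all)
  also have "\<dots> \<le> phi_const / sqrt T * ((exp 1 + 1) / T) * (T * (1 + 1 / r))"
    by (rule mult_left_mono[OF len1 C0]) (use T0 in \<open>simp add: add_nonneg_nonneg\<close>)
  also have "\<dots> = phi_const / sqrt T * ((exp 1 + 1) * (1 + 1 / r))" using T0 by simp
  finally have d1: "norm (K ?z - K ?w) \<le> phi_const / sqrt T * ((exp 1 + 1) * (1 + 1 / r))" .
  have "norm (L ?z - L ?v) \<le> phi_const / sqrt T * (1 / T) * norm (?z - ?v)"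
    by (rule phi_div_primitive_tail[OF L T]) (use Imz in simp_all)
  also have "\<dots> \<le> phi_const / sqrt T * (1 / T) * (T * (1 + 1 / r))"
    by (rule mult_left_mono[OF len2 C0]) (use T0 in simp)
  also have "\<dots> = phi_const / sqrt T * (1 + 1 / r)" using T0 by simp
  finally have d2: "norm (L ?z - L ?v) \<le> phi_const / sqrt T * (1 + 1 / r)" .
  have "norm (L ?v - L ?u) \<le> phi_const / sqrt T * (1 / T) * norm (?v - ?u)"
    by (rule phi_div_primitive_tail[OF L T]) simp_all
  also have "\<dots> \<le> phi_const / sqrt T * (1 / T) * T"
    by (rule mult_left_mono[OF len3 C0]) (use T0 in simp)
  also have "\<dots> = phi_const / sqrt T * 1" using T0 by simp
  finally have d3: "norm (L ?v - L ?u) \<le> phi_const / sqrt T * 1" .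
  \<comment> \<open>Telescoping along the two detours, with \<open>1\<close> replaced by
    \<open>0\<close> in \<open>K\<close> and by \<open>?u\<close> in \<open>L\<close>.\<close>
  have "Im (K ?z + L ?z - (K 1 + L 1)) - (Im (K ?w) - Im (K 0))
      = Im (K ?z - K ?w) + Im (L ?z - L ?v) + Im (L ?v - L ?u)"
    using K1 L1 by simp
  then have "\<bar>Im (K ?z + L ?z - (K 1 + L 1)) - (Im (K ?w) - Im (K 0))\<bar>
      \<le> norm (K ?z - K ?w) + norm (L ?z - L ?v) + norm (L ?v - L ?u)"
    using abs_Im_le_cmod[of "K ?z - K ?w"] abs_Im_le_cmod[of "L ?z - L ?v"] abs_Im_le_cmod[of "L ?v - L ?u"]
    by linarith
  also have "\<dots> \<le> phi_const / sqrt T * ((exp 1 + 1) * (1 + 1 / r)) + phi_const / sqrt T * (1 + 1 / r)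
      + phi_const / sqrt T * 1"
    by (intro add_mono d1 d2 d3)
  also have "\<dots> = phi_const * ((exp 1 + 1) * (1 + 1 / r) + (1 + 1 / r) + 1) / sqrt T"
    by (simp only: distrib_left add_divide_distrib times_divide_eq_left)
  finally show ?thesis .
qed

text \<open>The ray integral converges absolutely, so it is the limit of its truncations, and these
  differ from the given sequence by O(1 / sqrt N).\<close>

lemma ray_integral_eq_limit:
  assumes K: "\<And>z. z \<in> slit delta \<Longrightarrow> (K has_field_derivative kern z) (at z)"
    and r: "r > 0"
    and lim: "(\<lambda>N. Im (K (\<i> * complex_of_real (real N))) - Im (K 0)) \<longlonglongrightarrow> pi * p"
  shows "(LBINT t:{0..}. Im (ray_integrand r t)) = p"
proof -
  obtain L where L: "\<And>z. z \<in> slit 0 \<Longrightarrow> (L has_field_derivative phi z / z) (at z)"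
    using phi_div_primitive by blast
  let ?g = "\<lambda>t. indicator {0..} t *\<^sub>R ray_integrand r t"
  let ?J = "CLBINT t. ?g t"
  let ?D = "\<lambda>N. K (ray r (real N / r)) + L (ray r (real N / r)) - (K 1 + L 1)"
  define C where "C = phi_const * ((exp 1 + 1) * (1 + 1 / r) + (1 + 1 / r) + 1)"
  have int: "integrable lborel ?g"
    using set_integrable_ray_integrand[OF r] by (simp only: set_integrable_def)
  have "((\<lambda>s. CLBINT t. indicator {..s} t *\<^sub>R ?g t) \<longlongrightarrow> ?J) at_top"
    by (rule tendsto_integral_at_top[OF _ int]) simp
  \<comment> \<open>Truncation at \<open>N / r\<close> ends the ray at height N, the height reached
    on the imaginary axis.\<close>
  moreover have "filterlim (\<lambda>N. real N / r) at_top sequentially"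
    using r by (intro filterlim_at_top_mult_tendsto_pos[where f = "\<lambda>_. 1 / r" and c = "1 / r", simplified]
        filterlim_real_sequentially) auto
  ultimately have "(\<lambda>N. CLBINT t. indicator {..real N / r} t *\<^sub>R ?g t) \<longlonglongrightarrow> ?J"
    by (rule filterlim_compose)
  moreover have "(CLBINT t. indicator {..real N / r} t *\<^sub>R ?g t) = complex_of_real (1 / pi) * ?D N" for N
    using ray_integral_partial[OF K L r, of "real N / r"] r by (simp only: right_diff_distrib) simp
  ultimately have "(\<lambda>N. complex_of_real (1 / pi) * ?D N) \<longlonglongrightarrow> ?J"
    by (simp only:)
  then have "(\<lambda>N. Im (complex_of_real (1 / pi) * ?D N)) \<longlonglongrightarrow> Im ?J"
    by (rule tendsto_Im)
  moreover have "Im (complex_of_real a * w) = a * Im w" for a w by simp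
  ultimately have "(\<lambda>N. 1 / pi * Im (?D N)) \<longlonglongrightarrow> Im ?J" by (simp only:)
  from tendsto_mult_left[OF this, of pi] have D: "(\<lambda>N. Im (?D N)) \<longlonglongrightarrow> pi * Im ?J"
    by (simp only: mult.assoc[symmetric] nonzero_mult_div_cancel_left[OF pi_neq_zero] times_divide_eq_right mult_1_right mult_1_left divide_self[OF pi_neq_zero])
  have "(\<lambda>N. Im (?D N) - (Im (K (\<i> * complex_of_real (real N))) - Im (K 0))) \<longlonglongrightarrow> 0"
  proof (rule Lim_null_comparison)
    have "norm (Im (?D N) - (Im (K (\<i> * complex_of_real (real N))) - Im (K 0))) \<le> C / sqrt (real N)"
      if "N \<ge> 1" for N
      using contour_difference_bound[OF K L r, of "real N"] that by (simp only: C_def real_norm_def)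
    then show "\<forall>\<^sub>F N in sequentially. norm (Im (?D N) - (Im (K (\<i> * complex_of_real (real N))) - Im (K 0)))
        \<le> C / sqrt (real N)"
      unfolding eventually_sequentially by blast
    show "(\<lambda>N. C / sqrt (real N)) \<longlonglongrightarrow> 0"
      by (intro real_tendsto_divide_at_top[OF tendsto_const] filterlim_compose[OF sqrt_at_top filterlim_real_sequentially])
  qed
  from tendsto_add[OF this lim] have "(\<lambda>N. Im (?D N)) \<longlonglongrightarrow> pi * p" by simp
  with D have "pi * Im ?J = pi * p" by (rule LIMSEQ_unique)
  then have "Im ?J = p" by simp
  moreover have "Im ?J = (LBINT t. Im (?g t))"
    using integral_Im[OF int] by simp
  moreover have "(LBINT t. Im (?g t)) = (LBINT t:{0..}. Im (ray_integrand r t))"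
    unfolding set_lebesgue_integral_def
    by (rule Bochner_Integration.integral_cong) simp_all
  ultimately show ?thesis by simp
qed

end

section \<open>The distribution function\<close>

context prob_space
begin

lemma indep_vars_scaled_squares:
  assumes "indep_vars (\<lambda>_. borel) X I"
  shows "indep_vars (\<lambda>_. borel) (\<lambda>k \<omega>. a k * (X k \<omega> :: real)\<^sup>2) I"
  by (rule indep_vars_compose2[OF assms]) measurable

lemma emeasure_quadratic_form_singleton:
  assumes ind: "indep_vars (\<lambda>_. borel) X I" and I: "finite I" "I \<noteq> {}"
    and X: "\<And>k. k \<in> I \<Longrightarrow> distributed M lborel (X k) std_normal_density"
    and a: "\<And>k. k \<in> I \<Longrightarrow> a k \<noteq> 0"
  shows "emeasure (distr M borel (\<lambda>\<omega>. \<Sum>k\<in>I. a k * (X k \<omega>)\<^sup>2)) {y} = 0"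
proof -
  obtain j where j: "j \<in> I" using I by blast
  show ?thesis
    using emeasure_scaled_square_std_normal_singleton[OF X[OF j] a[OF j]]
    by (rule emeasure_indep_sum_singleton[OF indep_vars_scaled_squares[OF ind] I(1) j])
qed

lemma char_quadratic_form:
  assumes ind: "indep_vars (\<lambda>_. borel) X I"
    and X: "\<And>k. k \<in> I \<Longrightarrow> distributed M lborel (X k) std_normal_density"
  shows "char (distr M borel (\<lambda>\<omega>. \<Sum>k\<in>I. a k * (X k \<omega>)\<^sup>2)) t
    = (\<Prod>k\<in>I. 1 / csqrt (1 - 2 * \<i> * complex_of_real (a k * t)))"
  unfolding char_distr_sum[OF indep_vars_scaled_squares[OF ind]]
  by (rule prod.cong[OF refl]) (rule char_scaled_square_std_normal[OF X])

lemma random_variable_quadratic_form: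
  assumes "\<And>k. k \<in> I \<Longrightarrow> distributed M lborel (X k) std_normal_density"
  shows "random_variable borel (\<lambda>\<omega>. \<Sum>k\<in>I. a k * (X k \<omega>)\<^sup>2)"
proof (rule borel_measurable_sum)
  fix k assume "k \<in> I"
  then have [measurable]: "X k \<in> borel_measurable M"
    using distributed_measurable[OF assms] by simp
  show "(\<lambda>\<omega>. a k * (X k \<omega>)\<^sup>2) \<in> borel_measurable M" by measurable
qed

text \<open>The form is nonnegative, so the event lies in the event that it equals 0, which is null
  because its law has no atoms.\<close>

lemma prob_quadratic_form_le_0:
  assumes ind: "indep_vars (\<lambda>_. borel) X I" and I: "finite I" "I \<noteq> {}"
    and X: "\<And>k. k \<in> I \<Longrightarrow> distributed M lborel (X k) std_normal_density"
    and a: "\<And>k. k \<in> I \<Longrightarrow> a k > 0" and y: "y \<le> 0"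
  shows "prob {\<omega> \<in> space M. (\<Sum>k\<in>I. a k * (X k \<omega>)\<^sup>2) \<le> y} = 0"
proof -
  let ?Y = "\<lambda>\<omega>. \<Sum>k\<in>I. a k * (X k \<omega>)\<^sup>2"
  note [measurable] = random_variable_quadratic_form[of I X a, OF X]
  have nonneg: "?Y \<omega> \<ge> 0" for \<omega>
    by (intro sum_nonneg mult_nonneg_nonneg less_imp_le[OF a]) simp_all
  have "prob {\<omega> \<in> space M. ?Y \<omega> \<le> y} \<le> prob (?Y -` {0} \<inter> space M)"
    using y nonneg by (intro finite_measure_mono) (auto intro: antisym order_trans)
  also have "\<dots> = measure (distr M borel ?Y) {0}"
    by (rule measure_distr[symmetric]) simp_all
  also have "\<dots> = 0"
    using emeasure_quadratic_form_singleton[OF ind I X, of a 0] a by (force simp: measure_def)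
  finally show ?thesis by (simp add: antisym measure_nonneg)
qed

lemma prob_quadratic_form_le_1:
  assumes ind: "indep_vars (\<lambda>_. borel) X I" and I: "finite I" "I \<noteq> {}"
    and X: "\<And>k. k \<in> I \<Longrightarrow> distributed M lborel (X k) std_normal_density"
    and a: "\<And>k. k \<in> I \<Longrightarrow> a k > 0" and r: "r > 0"
  shows "prob {\<omega> \<in> space M. (\<Sum>k\<in>I. a k * (X k \<omega>)\<^sup>2) \<le> 1}
    = (LBINT t:{0..}. Im (quadratic_form_transform.ray_integrand (\<lambda>k. 2 * a k) I r t))"
proof -
  interpret T: quadratic_form_transform "\<lambda>k. 2 * a k" I
    by standard (use I a in auto)
  let ?Y = "\<lambda>\<omega>. \<Sum>k\<in>I. a k * (X k \<omega>)\<^sup>2"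
  let ?D = "distr M borel ?Y"
  have Y [measurable]: "random_variable borel ?Y" by (rule random_variable_quadratic_form[OF X])
  interpret D: real_distribution ?D by (rule real_distribution_distr[OF Y])
  have atom: "measure ?D {y} = 0" for y
    using emeasure_quadratic_form_singleton[OF ind I X, of a y] a by (force simp: measure_def)
  \<comment> \<open>A characteristic function is the Laplace transform at
    \<open>- \<i> * t\<close>.\<close>
  have char: "char ?D t = T.phi (- \<i> * complex_of_real t)" for t
    using char_quadratic_form[OF ind X, of a t] unfolding T.phi_def
    by (simp add: prod_dividef mult_ac)
  obtain K where K: "\<And>z. z \<in> T.slit T.delta \<Longrightarrow> (K has_field_derivative T.kern z) (at z)"
    using T.kern_primitive by blast
  have "(\<lambda>N::nat. 1 / (2 * pi) * (CLBINT t=ereal (- real N)..ereal (real N).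
      (iexp (-(t * 0)) - iexp (-(t * 1))) / (\<i> * t) * char ?D t)) \<longlonglongrightarrow> complex_of_real (measure ?D {0<..1})"
    using D.Levy_Inversion[of 0 1, OF _ atom atom] by simp
  then have "(\<lambda>N. complex_of_real (1 / (2 * pi)) *
      complex_of_real (2 * (Im (K (\<i> * complex_of_real (real N))) - Im (K 0))))
      \<longlonglongrightarrow> complex_of_real (measure ?D {0<..1})"
    unfolding char by (subst (asm) T.inversion_integral_eq[OF K]) simp_all
  then have "(\<lambda>N. 1 / (2 * pi) * (2 * (Im (K (\<i> * complex_of_real (real N))) - Im (K 0))))
      \<longlonglongrightarrow> measure ?D {0<..1}"
    by (simp only: of_real_mult[symmetric] tendsto_of_real_iff)
  from tendsto_mult_left[OF this, of pi]
  have "(\<lambda>N. pi * (1 / (2 * pi) * (2 * (Im (K (\<i> * complex_of_real (real N))) - Im (K 0)))))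
      \<longlonglongrightarrow> pi * measure ?D {0<..1}" .
  \<comment> \<open>The 2 from conjugate symmetry turns Levy's prefactor \<open>1 / (2 * pi)\<close>
    into the \<open>1 / pi\<close> of \<open>ray_integrand\<close>.\<close>
  moreover have "pi * (1 / (2 * pi) * (2 * w)) = w" for w :: real by simp
  ultimately have "(\<lambda>N. Im (K (\<i> * complex_of_real (real N))) - Im (K 0)) \<longlonglongrightarrow> pi * measure ?D {0<..1}"
    by (simp only:)
  from T.ray_integral_eq_limit[OF K r this]
  have "(LBINT t:{0..}. Im (T.ray_integrand r t)) = measure ?D {0<..1}" .
  also have "\<dots> = prob (?Y -` {0<..1} \<inter> space M)"
    by (rule measure_distr[OF Y]) simp
  \<comment> \<open>Levy's formula sees only (0, 1]; what is missing below 0 has probability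
    zero.\<close>
  also have "\<dots> = prob ({\<omega> \<in> space M. ?Y \<omega> \<le> 1} - {\<omega> \<in> space M. ?Y \<omega> \<le> 0})"
    by (rule arg_cong[where f = prob]) auto
  also have "\<dots> = prob {\<omega> \<in> space M. ?Y \<omega> \<le> 1} - prob {\<omega> \<in> space M. ?Y \<omega> \<le> 0}"
    by (rule finite_measure_Diff) auto
  also have "prob {\<omega> \<in> space M. ?Y \<omega> \<le> 0} = 0"
    by (rule prob_quadratic_form_le_0[OF ind I X a order_refl])
  finally show ?thesis by simp
qed

end

theorem mainTheorem1:
  fixes M :: "'a measure" and X :: "nat \<Rightarrow> 'a \<Rightarrow> real"
    and sigma :: "nat \<Rightarrow> real" and n :: nat
  assumes "prob_space M"
    and "n \<ge> 1"
    and "prob_space.indep_vars M (\<lambda>_. borel) X {1..n}"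
    and "\<And>k. k \<in> {1..n} \<Longrightarrow> distributed M lborel (X k) std_normal_density"
    and "\<And>k. k \<in> {1..n} \<Longrightarrow> sigma k > 0"
  defines "P \<equiv> (\<lambda>x::real. measure M {\<omega> \<in> space M. (\<Sum>k=1..n. \<bar>sigma k * X k \<omega>\<bar>^2) \<le> x})"
  shows "(\<forall>x::real. x \<le> 0 \<longrightarrow> P x = 0) \<and>
    (\<forall>x::real. x > 0 \<longrightarrow> P x =
      (LBINT t:{0..}. Im (
        exp (complex_of_real (1 - t)) * exp (\<i> * complex_of_real (t * sqrt (real n))) /
        (complex_of_real pi * (complex_of_real t - 1 / (1 - \<i> * complex_of_real (sqrt (real n)))) *
         (\<Prod>k=1..n. csqrt (1 - complex_of_real (2 * (t - 1) * (sigma k)^2 / x)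
                          + \<i> * complex_of_real (2 * t * (sigma k)^2 * sqrt (real n) / x)))))))"
proof (intro conjI allI impI)
  interpret prob_space M by fact
  have I: "finite {1..n}" "{1..n} \<noteq> {}" using assms(2) by auto
  note ind = assms(3) and X = assms(4) and sigma = assms(5)
  have sq: "(\<Sum>k=1..n. \<bar>sigma k * X k \<omega>\<bar>^2) = (\<Sum>k=1..n. (sigma k)\<^sup>2 * (X k \<omega>)\<^sup>2)" for \<omega>
    by (simp add: power_mult_distrib)
  {
    fix x :: real assume x: "x \<le> 0"
    show "P x = 0"
      unfolding P_def sq
      by (rule prob_quadratic_form_le_0[OF ind I X _ x]) (use sigma in force)+
  next
    fix x :: real assume x: "x > 0"
    \<comment> \<open>Dividing by x moves the threshold to 1, and the radicands of the claim become
      \<open>1 + 2 * a k * z\<close> with z on the ray.\<close>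
    define a where "a k = (sigma k)\<^sup>2 / x" for k
    have a: "a k > 0" if "k \<in> {1..n}" for k
      using sigma[OF that] x by (simp add: a_def)
    interpret T: quadratic_form_transform "\<lambda>k. 2 * a k" "{1..n}"
      by standard (use I a in auto)
    have "(\<Sum>k=1..n. \<bar>sigma k * X k \<omega>\<bar>^2) \<le> x \<longleftrightarrow> (\<Sum>k=1..n. a k * (X k \<omega>)\<^sup>2) \<le> 1" for \<omega>
      using x unfolding sq a_def by (simp add: sum_divide_distrib[symmetric])
    then have "P x = prob {\<omega> \<in> space M. (\<Sum>k=1..n. a k * (X k \<omega>)\<^sup>2) \<le> 1}"
      by (simp add: P_def)
    also have "\<dots> = (LBINT t:{0..}. Im (T.ray_integrand (sqrt (real n)) t))"
      by (rule prob_quadratic_form_le_1[OF ind I X a]) (use assms(2) in auto)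
    finally have "P x = (LBINT t:{0..}. Im (T.ray_integrand (sqrt (real n)) t))" .
    moreover have "T.ray_integrand (sqrt (real n)) t =
        exp (complex_of_real (1 - t)) * exp (\<i> * complex_of_real (t * sqrt (real n))) /
        (complex_of_real pi * (complex_of_real t - 1 / (1 - \<i> * complex_of_real (sqrt (real n)))) *
         (\<Prod>k=1..n. csqrt (1 - complex_of_real (2 * (t - 1) * (sigma k)^2 / x)
                          + \<i> * complex_of_real (2 * t * (sigma k)^2 * sqrt (real n) / x))))" for t
    proof -
      have "1 + complex_of_real (2 * a k) * T.ray (sqrt (real n)) t
          = 1 - complex_of_real (2 * (t - 1) * (sigma k)^2 / x)
              + \<i> * complex_of_real (2 * t * (sigma k)^2 * sqrt (real n) / x)" for k
        using x by (simp add: T.ray_def a_def field_simps)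
      then show ?thesis unfolding T.ray_integrand_def by (simp only:)
    qed
    ultimately show "P x = (LBINT t:{0..}. Im (
        exp (complex_of_real (1 - t)) * exp (\<i> * complex_of_real (t * sqrt (real n))) /
        (complex_of_real pi * (complex_of_real t - 1 / (1 - \<i> * complex_of_real (sqrt (real n)))) *
         (\<Prod>k=1..n. csqrt (1 - complex_of_real (2 * (t - 1) * (sigma k)^2 / x)
                          + \<i> * complex_of_real (2 * t * (sigma k)^2 * sqrt (real n) / x))))))"
      by (simp only:)
  }
qed

end
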